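(* Let $m,n,s$ be positive integers. Let $\Phi\in\mathbb{H}^{m\times n}$ satisfy the $2s$-restricted isometry property (for quaternion vectors) with a constant $\delta_{2s}<\sqrt{2}-1$. Then for any $x\in\mathbb{H}^n$ and $y=\Phi x\in\mathbb{H}^m$, every solution $x^{\#}$ of the problem $$\operatorname*{arg\,min}_{z\in\mathbb{H}^n}\|z\|_1\quad\text{subject to}\quad\Phi z=y$$ satisfies $$\|x^{\#}-x\|_1\leq C_0\|x-x_s\|_1\qquad\text{and}\qquad\|x^{\#}-x\|_2\leq\frac{C_0}{\sqrt{s}}\|x-x_s\|_1$$ with the constant $$C_0=2\cdot\frac{1+(\sqrt{2}-1)\delta_{2s}}{1-(\sqrt{2}+1)\delta_{2s}},$$ where $x_s$ denotes the best $s$-sparse approximation of $x$. In particular, if $x$ is $s$-sparse, then the reconstruction by $\ell_1$-norm minimization is exact, i.e. $x^{\#}=x$.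
   Context: $\mathbb{H}$ is the algebra of real quaternions $q=a+b\mathbf{i}+c\mathbf{j}+d\mathbf{k}$ with conjugate $\overline{q}=a-b\mathbf{i}-c\mathbf{j}-d\mathbf{k}$ and norm $|q|=\sqrt{q\overline{q}}=\sqrt{a^2+b^2+c^2+d^2}$. A matrix $\Phi\in\mathbb{H}^{m\times n}$ acts on column vectors $x\in\mathbb{H}^n$ by the usual matrix-vector multiplication (matrix entries on the left), so it is linear for right scalar multiplication. For $x=(x_1,\dots,x_n)^T\in\mathbb{H}^n$: $\|x\|_p=\left(\sum_i|x_i|^p\right)^{1/p}$ for $p\in[1,\infty)$, and $\|x\|_0$ is the number of nonzero coordinates of $x$. A vector $x$ is $s$-sparse if $\|x\|_0\leq s$. Restricted isometry property: $\Phi\in\mathbb{H}^{m\times n}$ satisfies the $s$-restricted isometry property (for quaternion vectors) with a constant $\delta_s\geq0$ if $(1-\delta_s)\|x\|_2^2\leq\|\Phi x\|_2^2\leq(1+\delta_s)\|x\|_2^2$ for all $s$-sparse $x\in\mathbb{H}^n$. The best $s$-sparse approximation $x_s$ of $x$ is the vector obtained from $x$ by keeping $s$ coordinates with the largest quaternion norms (all coordinates if $s\ge n$) and setting the others to $0$; ties may be broken arbitrarily, as $\|x-x_s\|_1$ does not depend on the choice. *)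

theory Defs
  imports "HOL-Analysis.Analysis"
begin

section \<open>Quaternions\<close>

text \<open>The quaternion \<open>a + b i + c j + d k\<close> is \<open>Quat a b c d\<close>.\<close>

codatatype quat = Quat (qRe: real) (qIm1: real) (qIm2: real) (qIm3: real)

lemma quat_eqI [intro?]:
  "qRe x = qRe y \<Longrightarrow> qIm1 x = qIm1 y \<Longrightarrow> qIm2 x = qIm2 y \<Longrightarrow> qIm3 x = qIm3 y \<Longrightarrow> x = y"
  by (rule quat.expand) simp

lemma quat_eq_iff:
  "x = y \<longleftrightarrow> qRe x = qRe y \<and> qIm1 x = qIm1 y \<and> qIm2 x = qIm2 y \<and> qIm3 x = qIm3 y"
  by (auto intro: quat.expand)

instantiation quat :: ab_group_add
begin

primcorec zero_quat where
  "qRe 0 = 0" | "qIm1 0 = 0" | "qIm2 0 = 0" | "qIm3 0 = 0"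

primcorec plus_quat where
  "qRe (x + y) = qRe x + qRe y"
| "qIm1 (x + y) = qIm1 x + qIm1 y"
| "qIm2 (x + y) = qIm2 x + qIm2 y"
| "qIm3 (x + y) = qIm3 x + qIm3 y"

primcorec uminus_quat where
  "qRe (- x) = - qRe x"
| "qIm1 (- x) = - qIm1 x"
| "qIm2 (- x) = - qIm2 x"
| "qIm3 (- x) = - qIm3 x"

primcorec minus_quat where
  "qRe (x - y) = qRe x - qRe y"
| "qIm1 (x - y) = qIm1 x - qIm1 y"
| "qIm2 (x - y) = qIm2 x - qIm2 y"
| "qIm3 (x - y) = qIm3 x - qIm3 y"

instance
  by standard (simp_all add: quat_eq_iff)

end

instantiation quat :: ring_1
begin

primcorec one_quat where
  "qRe 1 = 1" | "qIm1 1 = 0" | "qIm2 1 = 0" | "qIm3 1 = 0"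

primcorec times_quat where
  "qRe (x * y) = qRe x * qRe y - qIm1 x * qIm1 y - qIm2 x * qIm2 y - qIm3 x * qIm3 y"
| "qIm1 (x * y) = qRe x * qIm1 y + qIm1 x * qRe y + qIm2 x * qIm3 y - qIm3 x * qIm2 y"
| "qIm2 (x * y) = qRe x * qIm2 y - qIm1 x * qIm3 y + qIm2 x * qRe y + qIm3 x * qIm1 y"
| "qIm3 (x * y) = qRe x * qIm3 y + qIm1 x * qIm2 y - qIm2 x * qIm1 y + qIm3 x * qRe y"

instance
  by standard (simp_all add: quat_eq_iff algebra_simps)

end

lemma quat_units:
  fixes i j k :: quat
  defines "i \<equiv> Quat 0 1 0 0" and "j \<equiv> Quat 0 0 1 0" and "k \<equiv> Quat 0 0 0 1"
  shows "i * i = - 1" "j * j = - 1" "k * k = - 1"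
    "i * j = k" "j * k = i" "k * i = j" "j * i = - k" "k * j = - i" "i * k = - j"
  by (simp_all add: i_def j_def k_def quat_eq_iff)

instantiation quat :: real_algebra_1
begin

primcorec scaleR_quat where
  "qRe (scaleR r x) = r * qRe x"
| "qIm1 (scaleR r x) = r * qIm1 x"
| "qIm2 (scaleR r x) = r * qIm2 x"
| "qIm3 (scaleR r x) = r * qIm3 x"

instance
  by standard (simp_all add: quat_eq_iff algebra_simps)

end

primcorec qcnj :: "quat \<Rightarrow> quat" where
  "qRe (qcnj q) = qRe q"
| "qIm1 (qcnj q) = - qIm1 q"
| "qIm2 (qcnj q) = - qIm2 q"
| "qIm3 (qcnj q) = - qIm3 q"

instantiation quat :: real_inner
begin

definition "inner x y = qRe x * qRe y + qIm1 x * qIm1 y + qIm2 x * qIm2 y + qIm3 x * qIm3 y"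
  for x y :: quat

definition "norm q = sqrt ((qRe q)\<^sup>2 + (qIm1 q)\<^sup>2 + (qIm2 q)\<^sup>2 + (qIm3 q)\<^sup>2)"
  for q :: quat

definition "sgn q = q /\<^sub>R norm q" for q :: quat

definition "dist x y = norm (x - y)" for x y :: quat

definition
  "(uniformity :: (quat \<times> quat) filter) = (INF e\<in>{0 <..}. principal {(x, y). dist x y < e})"

definition
  "open (U :: quat set) \<longleftrightarrow> (\<forall>x\<in>U. eventually (\<lambda>(x', y). x' = x \<longrightarrow> y \<in> U) uniformity)"

instance
proof
  fix r :: real and x y z :: quat
  show "dist x y = norm (x - y)" "sgn x = x /\<^sub>R norm x"
    by (simp_all add: dist_quat_def sgn_quat_def)
  show "inner x y = inner y x" "inner (x + y) z = inner x z + inner y z"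
    "inner (scaleR r x) y = r * inner x y"
    by (simp_all add: inner_quat_def algebra_simps)
  show "0 \<le> inner x x" "norm x = sqrt (inner x x)"
    by (simp_all add: inner_quat_def norm_quat_def power2_eq_square)
  show "inner x x = 0 \<longleftrightarrow> x = 0"
    by (simp add: inner_quat_def quat_eq_iff add_nonneg_eq_0_iff)
qed (simp_all add: uniformity_quat_def open_quat_def)

end

lemma norm_quat_qcnj: "of_real ((norm q)\<^sup>2) = q * qcnj q"
  by (simp add: quat_eq_iff norm_quat_def of_real_def power2_eq_square algebra_simps)

lemma norm_quat_mult: "norm (x * y) = norm x * norm y" for x y :: quat
  unfolding norm_quat_def real_sqrt_mult [symmetric] times_quat.sel
  by (rule arg_cong [where f = sqrt]) algebra

instantiation quat :: real_normed_div_algebra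
begin

definition "inverse q = qcnj q /\<^sub>R (norm q)\<^sup>2" for q :: quat

definition "x div y = x * inverse y" for x y :: quat

instance
proof
  fix x y :: quat
  have x: "x * qcnj x = (norm x)\<^sup>2 *\<^sub>R 1" "qcnj x * x = (norm x)\<^sup>2 *\<^sub>R 1"
    by (simp_all add: quat_eq_iff norm_quat_def power2_eq_square algebra_simps)
  show "x \<noteq> 0 \<Longrightarrow> inverse x * x = 1" "x \<noteq> 0 \<Longrightarrow> x * inverse x = 1"
    by (simp_all add: inverse_quat_def x)
  show "inverse (0 :: quat) = 0"
    by (simp add: inverse_quat_def quat_eq_iff)
qed (simp_all add: divide_quat_def norm_quat_mult)

end


section \<open>Sparse vectors and the restricted isometry property\<close>

definition lp_norm :: "real \<Rightarrow> 'a::real_normed_vector ^ 'n \<Rightarrow> real" where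
  "lp_norm p x = (\<Sum>i\<in>UNIV. norm (x $ i) powr p) powr (1 / p)"

lemma lp_norm_1: "lp_norm 1 x = (\<Sum>i\<in>UNIV. norm (x $ i))"
  by (simp add: lp_norm_def sum_nonneg)

lemma lp_norm_2: "lp_norm 2 x = norm x"
  by (simp add: lp_norm_def norm_vec_def L2_set_def powr_half_sqrt sum_nonneg)

definition l0_norm :: "'a::zero ^ 'n \<Rightarrow> nat" where
  "l0_norm x = card {i. x $ i \<noteq> 0}"

definition is_sparse :: "nat \<Rightarrow> 'a::zero ^ 'n \<Rightarrow> bool" where
  "is_sparse s x \<longleftrightarrow> l0_norm x \<le> s"

definition restricted_isometry :: "nat \<Rightarrow> quat ^ 'n ^ 'm \<Rightarrow> real \<Rightarrow> bool" where
  "restricted_isometry s \<Phi> \<delta> \<longleftrightarrow> 0 \<le> \<delta> \<and>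
     (\<forall>x. is_sparse s x \<longrightarrow>
        (1 - \<delta>) * (lp_norm 2 x)\<^sup>2 \<le> (lp_norm 2 (\<Phi> *v x))\<^sup>2 \<and>
        (lp_norm 2 (\<Phi> *v x))\<^sup>2 \<le> (1 + \<delta>) * (lp_norm 2 x)\<^sup>2)"

text \<open>
  Ties may be broken arbitrarily, so this is a relation: \<open>z\<close> is one of the vectors obtained
  from \<open>x\<close> by keeping \<open>s\<close> (or all, if there are fewer) coordinates of largest norm.
\<close>

definition best_sparse_approx ::
    "nat \<Rightarrow> 'a::real_normed_vector ^ 'n \<Rightarrow> 'a ^ 'n \<Rightarrow> bool" where
  "best_sparse_approx s x z \<longleftrightarrow>
     (\<exists>S :: 'n set. card S = min s CARD('n) \<and>
        (\<forall>i\<in>S. \<forall>j\<in>- S. norm (x $ j) \<le> norm (x $ i)) \<and>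
        z = (\<chi> i. if i \<in> S then x $ i else 0))"

lemma best_sparse_approx_exists: "\<exists>z. best_sparse_approx s x z"
  for x :: "'a::real_normed_vector ^ 'n"
proof -
  have "\<exists>S :: 'n set. card S = k \<and> (\<forall>i\<in>S. \<forall>j\<in>- S. norm (x $ j) \<le> norm (x $ i))"
    if "k \<le> CARD('n)" for k
    using that
  proof (induction k)
    case 0
    show ?case by (intro exI [of _ "{}"]) simp
  next
    case (Suc k)
    then obtain S :: "'n set" where S: "card S = k"
      "\<forall>i\<in>S. \<forall>j\<in>- S. norm (x $ j) \<le> norm (x $ i)" by auto
    have "S \<noteq> UNIV"
      using S(1) Suc.prems by auto
    then have "- S \<noteq> {}"
      by blast
    define M where "M = Max ((\<lambda>i. norm (x $ i)) ` (- S))"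
    have "M \<in> (\<lambda>i. norm (x $ i)) ` (- S)"
      unfolding M_def using \<open>- S \<noteq> {}\<close> by (intro Max_in) auto
    then obtain m where m: "m \<in> - S" "M = norm (x $ m)"
      by auto
    have m': "norm (x $ j) \<le> norm (x $ m)" if "j \<in> - S" for j
      unfolding m(2) [symmetric] M_def using that by (intro Max_ge) auto
    show ?case
      using S m(1) m' by (intro exI [of _ "insert m S"]) auto
  qed
  from this [of "min s CARD('n)"] show ?thesis
    unfolding best_sparse_approx_def by auto
qed

end

theory Submission
  imports Defs
begin

text \<open>
  Only the real structure matters: \<open>\<Phi>\<close> is real linear, and the real inner product on
  \<open>quat ^ 'm\<close> is the real part of the quaternionic one, so polarization turns the restricted
  isometry property into \<open>\<bar>\<langle>\<Phi> u, \<Phi> v\<rangle>\<bar> \<le> \<delta> \<parallel>u\<parallel> \<parallel>v\<parallel>\<close> for \<open>s\<close>-sparse \<open>u\<close>, \<open>v\<close> with disjoint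
  supports. Let \<open>h = x\<^sup># - x\<close>, let \<open>T\<close> be the index set kept in \<open>x\<^sub>s\<close>, let \<open>U\<close> consist of the \<open>s\<close>
  largest coordinates of \<open>h\<close> outside \<open>T\<close>, and cut the remaining set \<open>R\<close> into blocks of \<open>s\<close>
  coordinates in decreasing order of norm. The 2-norm of a block is at most \<open>1 / sqrt s\<close> times
  the 1-norm of its predecessor. As \<open>\<Phi> h = 0\<close>, expanding \<open>\<langle>\<Phi> h\<^bsub>T \<union> U\<^esub>, \<Phi> h\<^sub>R\<rangle>\<close> blockwise bounds
  \<open>\<parallel>h\<^bsub>T \<union> U\<^esub>\<parallel>\<^sub>2\<close> by \<open>\<rho> / sqrt s\<close> times the 1-norm of \<open>h\<close> off \<open>T\<close>, with
  \<open>\<rho> = sqrt 2 * \<delta> / (1 - \<delta>) < 1\<close>. Minimality of \<open>x\<^sup>#\<close> bounds the 1-norm of \<open>h\<close> off \<open>T\<close> by its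
  1-norm on \<open>T\<close> plus \<open>2 \<parallel>x - x\<^sub>s\<parallel>\<^sub>1\<close>, and the two estimates combine to the claim.
\<close>

section \<open>Restriction of vectors to index sets, sparsity counts and norms\<close>

definition vrestrict :: "'n set \<Rightarrow> 'a::zero ^ 'n \<Rightarrow> 'a ^ 'n" where
  "vrestrict A x = (\<chi> i. if i \<in> A then x $ i else 0)"

lemma vrestrict_nth [simp]: "vrestrict A x $ i = (if i \<in> A then x $ i else 0)"
  by (simp add: vrestrict_def)

lemma vrestrict_UNIV [simp]: "vrestrict UNIV x = x"
  by (simp add: vec_eq_iff)

lemma vrestrict_Un:
  fixes x :: "'a::monoid_add ^ 'n"
  assumes "A \<inter> B = {}"
  shows "vrestrict (A \<union> B) x = vrestrict A x + vrestrict B x"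
  using assms by (auto simp: vec_eq_iff)

lemma l0_norm_vrestrict_le: "l0_norm (vrestrict A x) \<le> card A"
  for x :: "'a::zero ^ 'n"
  unfolding l0_norm_def by (intro card_mono) auto

lemma l0_norm_add_le: "l0_norm (x + y) \<le> l0_norm x + l0_norm y"
  for x y :: "'a::monoid_add ^ 'n"
proof -
  have "l0_norm (x + y) \<le> card ({i. x $ i \<noteq> 0} \<union> {i. y $ i \<noteq> 0})"
    unfolding l0_norm_def by (intro card_mono) auto
  also have "\<dots> \<le> l0_norm x + l0_norm y"
    unfolding l0_norm_def by (rule card_Un_le)
  finally show ?thesis .
qed

lemma l0_norm_scaleR_le: "l0_norm (r *\<^sub>R x) \<le> l0_norm x"
  for x :: "'a::real_vector ^ 'n"
  unfolding l0_norm_def by (intro card_mono) auto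

lemma norm_vrestrict: "norm (vrestrict A x) = L2_set (\<lambda>i. norm (x $ i)) A"
  for x :: "'a::real_normed_vector ^ 'n"
proof -
  have "(\<Sum>i\<in>UNIV. (norm (vrestrict A x $ i))\<^sup>2) = (\<Sum>i\<in>A. (norm (x $ i))\<^sup>2)"
    by (rule sum.mono_neutral_cong_right) auto
  then show ?thesis
    by (simp add: norm_vec_def L2_set_def)
qed

lemma norm_vrestrict_le_of_bound:
  fixes x :: "'a::real_normed_vector ^ 'n"
  assumes "card A \<le> s" "M \<ge> 0" "\<And>i. i \<in> A \<Longrightarrow> norm (x $ i) \<le> M"
  shows "norm (vrestrict A x) \<le> sqrt s * M"
proof -
  have "(\<Sum>i\<in>A. (norm (x $ i))\<^sup>2) \<le> (\<Sum>i\<in>A. M\<^sup>2)"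
    using assms by (intro sum_mono power_mono) auto
  also have "\<dots> \<le> s * M\<^sup>2"
    using assms by (simp add: mult_right_mono)
  finally have "sqrt (\<Sum>i\<in>A. (norm (x $ i))\<^sup>2) \<le> sqrt (s * M\<^sup>2)"
    by (rule real_sqrt_le_mono)
  then show ?thesis
    using assms by (simp add: norm_vrestrict L2_set_def real_sqrt_mult)
qed

lemma sum_norm_le_sqrt_norm_vrestrict:
  fixes x :: "'a::real_normed_vector ^ 'n"
  assumes "card A \<le> s"
  shows "(\<Sum>i\<in>A. norm (x $ i)) \<le> sqrt s * norm (vrestrict A x)"
proof -
  have "(\<Sum>i\<in>A. norm (x $ i)) \<le> L2_set (\<lambda>i. 1) A * L2_set (\<lambda>i. norm (x $ i)) A"
    using L2_set_mult_ineq [of "\<lambda>i. 1" "\<lambda>i. norm (x $ i)" A] by simp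
  also have "\<dots> \<le> sqrt s * L2_set (\<lambda>i. norm (x $ i)) A"
    using assms by (intro mult_right_mono) (auto simp: L2_set_def sum_nonneg)
  finally show ?thesis by (simp add: norm_vrestrict)
qed

section \<open>Sorting coordinates into blocks of decreasing size\<close>

lemma largest_subset_exists:
  fixes f :: "'i \<Rightarrow> real"
  assumes "finite A" "k \<le> card A"
  shows "\<exists>T\<subseteq>A. card T = k \<and> (\<forall>i\<in>T. \<forall>j\<in>A - T. f j \<le> f i)"
  using assms(2)
proof (induction k)
  case 0
  show ?case by (intro exI [of _ "{}"]) simp
next
  case (Suc k)
  then obtain T where T: "T \<subseteq> A" "card T = k" "\<forall>i\<in>T. \<forall>j\<in>A - T. f j \<le> f i"
    by auto
  have fin: "finite (A - T)" "finite T"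
    using assms(1) T(1) by (auto intro: finite_subset)
  have "A - T \<noteq> {}"
    using Suc.prems T(1,2) by auto
  then have "Max (f ` (A - T)) \<in> f ` (A - T)"
    using fin by (intro Max_in) auto
  then obtain m where m: "m \<in> A - T" "Max (f ` (A - T)) = f m"
    by auto
  have "f j \<le> f m" if "j \<in> A - T" for j
    unfolding m(2) [symmetric] using that fin by (intro Max_ge) auto
  then show ?case
    using T m(1) fin by (intro exI [of _ "insert m T"]) auto
qed

text \<open>A minimum is at most the average. This links consecutive blocks: the least norm in one
  block bounds every coordinate of the next, so the 2-norm of the next is paid for by the 1-norm of
  this one.\<close>

lemma sqrt_card_mult_Min_le:
  fixes f :: "'i \<Rightarrow> real"
  assumes "finite T" "card T = s" "s \<ge> 1"
  shows "sqrt s * Min (f ` T) \<le> (\<Sum>i\<in>T. f i) / sqrt s"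
proof -
  have "s * Min (f ` T) = (\<Sum>i\<in>T. Min (f ` T))"
    using assms by simp
  also have "\<dots> \<le> (\<Sum>i\<in>T. f i)"
    using assms by (intro sum_mono Min_le) auto
  finally have "(sqrt s * Min (f ` T)) * sqrt s \<le> (\<Sum>i\<in>T. f i)"
    using real_sqrt_mult_self [of "real s"] by (metis abs_of_nat mult.assoc mult.commute)
  then show ?thesis
    using assms(3) by (subst pos_le_divide_eq) auto
qed

text \<open>
  The induction splits off the \<open>s\<close> largest coordinates; their smallest norm is the bound \<open>M\<close>
  for the rest.
\<close>

lemma subadditive_block_bound:
  fixes x :: "'a::real_normed_vector ^ 'n" and g :: "'n set \<Rightarrow> real"
  assumes s: "s \<ge> 1" and c: "c \<ge> 0"
    and sub: "\<And>A B. A \<subseteq> D \<Longrightarrow> B \<subseteq> D \<Longrightarrow> A \<inter> B = {} \<Longrightarrow> g (A \<union> B) \<le> g A + g B"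
    and small: "\<And>A. A \<subseteq> D \<Longrightarrow> card A \<le> s \<Longrightarrow> g A \<le> c * norm (vrestrict A x)"
    and "A \<subseteq> D" "M \<ge> 0" "\<And>i. i \<in> A \<Longrightarrow> norm (x $ i) \<le> M"
  shows "g A \<le> c * (sqrt s * M + (\<Sum>i\<in>A. norm (x $ i)) / sqrt s)"
  using assms(5-)
proof (induction "card A" arbitrary: A M rule: less_induct)
  case less
  let ?N = "\<lambda>A. \<Sum>i\<in>A. norm (x $ i)"
  show ?case
  proof (cases "card A \<le> s")
    case True
    have "g A \<le> c * norm (vrestrict A x)"
      using small less.prems True by blast
    also have "\<dots> \<le> c * (sqrt s * M)"
      using True less.prems c by (intro mult_left_mono norm_vrestrict_le_of_bound) auto
    also have "\<dots> \<le> c * (sqrt s * M + ?N A / sqrt s)"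
      using c by (intro mult_left_mono) (auto simp: sum_nonneg)
    finally show ?thesis .
  next
    case False
    then obtain T where T: "T \<subseteq> A" "card T = s"
      "\<forall>i\<in>T. \<forall>j\<in>A - T. norm (x $ j) \<le> norm (x $ i)"
      using largest_subset_exists [of A s "\<lambda>i. norm (x $ i)"] by auto
    define M' where "M' = Min ((\<lambda>i. norm (x $ i)) ` T)"
    have "T \<noteq> {}" using T(2) s by auto
    then have "M' \<in> (\<lambda>i. norm (x $ i)) ` T"
      unfolding M'_def by (intro Min_in) auto
    then have M': "M' \<ge> 0" "\<And>j. j \<in> A - T \<Longrightarrow> norm (x $ j) \<le> M'"
      using T(3) by auto
    have "card (A - T) < card A"
      using T(1) \<open>T \<noteq> {}\<close> by (intro psubset_card_mono) auto
    then have rest: "g (A - T) \<le> c * (sqrt s * M' + ?N (A - T) / sqrt s)"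
      using less.prems M' by (intro less.hyps) auto
    have "g A \<le> g T + g (A - T)"
      using sub [of T "A - T"] T(1) less.prems(1) by (auto simp: Un_absorb1)
    also have "g T \<le> c * norm (vrestrict T x)"
      using T less.prems by (intro small) auto
    also have "norm (vrestrict T x) \<le> sqrt s * M"
      using T less.prems by (intro norm_vrestrict_le_of_bound) auto
    also note rest
    \<comment> \<open>The cost of the bound \<open>M'\<close> for the remainder is charged to the
      1-norm of \<open>T\<close>, so that the two 1-norms add up to that of
      \<open>A\<close>.\<close>
    also have "sqrt s * M' \<le> ?N T / sqrt s"
      unfolding M'_def using T(2) s by (intro sqrt_card_mult_Min_le) auto
    finally have "g A \<le> c * (sqrt s * M) + c * (?N T / sqrt s + ?N (A - T) / sqrt s)"
      using c by (simp add: mult_left_mono)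
    also have "?N T / sqrt s + ?N (A - T) / sqrt s = ?N A / sqrt s"
      using sum.subset_diff [OF T(1), of "\<lambda>i. norm (x $ i)"] by (simp add: add_divide_distrib)
    finally show ?thesis
      by (simp add: distrib_left)
  qed
qed

text \<open>The set \<open>U\<close> acts as the block before \<open>D\<close>: its least norm
  serves as \<open>M\<close>, and its 1-norm absorbs the term with \<open>M\<close>. If
  \<open>D\<close> is empty, \<open>U\<close> may have fewer than \<open>s\<close> elements.\<close>

lemma subadditive_tail_bound:
  fixes x :: "'a::real_normed_vector ^ 'n" and g :: "'n set \<Rightarrow> real"
  assumes s: "s \<ge> 1" and c: "c \<ge> 0"
    and sub: "\<And>A B. A \<subseteq> D \<Longrightarrow> B \<subseteq> D \<Longrightarrow> A \<inter> B = {} \<Longrightarrow> g (A \<union> B) \<le> g A + g B"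
    and small: "\<And>A. A \<subseteq> D \<Longrightarrow> card A \<le> s \<Longrightarrow> g A \<le> c * norm (vrestrict A x)"
    and disj: "D \<inter> U = {}" and card: "D = {} \<or> card U = s"
    and top: "\<forall>i\<in>U. \<forall>j\<in>D. norm (x $ j) \<le> norm (x $ i)"
  shows "g D \<le> c * ((\<Sum>i\<in>U \<union> D. norm (x $ i)) / sqrt s)"
proof (cases "D = {}")
  case True
  have "g D \<le> c * norm (vrestrict D x)"
    using small True by simp
  also have "norm (vrestrict D x) = 0"
    using True by (simp add: norm_vrestrict)
  also have "c * 0 \<le> c * ((\<Sum>i\<in>U \<union> D. norm (x $ i)) / sqrt s)"
    using c by (intro mult_left_mono) (auto simp: sum_nonneg)
  finally show ?thesis .
next
  case False
  define M where "M = Min ((\<lambda>i. norm (x $ i)) ` U)"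
  have "M \<in> (\<lambda>i. norm (x $ i)) ` U"
    unfolding M_def using card s False by (intro Min_in) auto
  then have M: "M \<ge> 0" "\<And>j. j \<in> D \<Longrightarrow> norm (x $ j) \<le> M"
    using top by auto
  have "g D \<le> c * (sqrt s * M + (\<Sum>i\<in>D. norm (x $ i)) / sqrt s)"
    using M by (intro subadditive_block_bound [where D = D] s c sub small) auto
  also have "sqrt s * M \<le> (\<Sum>i\<in>U. norm (x $ i)) / sqrt s"
    unfolding M_def using card False s by (intro sqrt_card_mult_Min_le) auto
  also have "(\<Sum>i\<in>U. norm (x $ i)) / sqrt s + (\<Sum>i\<in>D. norm (x $ i)) / sqrt s
      = (\<Sum>i\<in>U \<union> D. norm (x $ i)) / sqrt s"
    using disj by (subst sum.union_disjoint) (auto simp: add_divide_distrib)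
  finally show ?thesis
    using c by (simp add: mult_left_mono)
qed

section \<open>Consequences of the restricted isometry property\<close>

text \<open>Polarization, with the upper isometry bound for the sum and the lower one for the
  difference. Replacing \<open>u\<close> by \<open>- u\<close> gives the bound for the opposite
  sign.\<close>

lemma restricted_isometry_inner_le:
  fixes f :: "'a::real_inner ^ 'n \<Rightarrow> 'b::real_inner" and u v :: "'a ^ 'n"
  assumes lin: "linear f"
    and rip: "\<And>x. l0_norm x \<le> 2 * s \<Longrightarrow>
      (1 - \<delta>) * (norm x)\<^sup>2 \<le> (norm (f x))\<^sup>2 \<and> (norm (f x))\<^sup>2 \<le> (1 + \<delta>) * (norm x)\<^sup>2"
    and sparse: "l0_norm u \<le> s" "l0_norm v \<le> s"
    and orth: "inner u v = 0"
  shows "inner (f u) (f v) \<le> \<delta> * norm u * norm v"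
proof (cases "u = 0 \<or> v = 0")
  case True
  then show ?thesis using linear_0 [OF lin] by auto
next
  case False
  \<comment> \<open>Crosswise scaling gives \<open>u\<close> and \<open>v\<close> the same norm
    \<open>a * b\<close>; without it the bound would contain the mean of the squared norms instead
    of their product.\<close>
  define a b where "a = norm v" and "b = norm u"
  have ab: "a > 0" "b > 0"
    using False by (auto simp: a_def b_def)
  have sp: "l0_norm (a *\<^sub>R u + r *\<^sub>R v) \<le> 2 * s" for r
    using l0_norm_add_le [of "a *\<^sub>R u" "r *\<^sub>R v"] l0_norm_scaleR_le [of a u]
      l0_norm_scaleR_le [of r v] sparse by linarith
  have nrm: "(norm (a *\<^sub>R u + r *\<^sub>R v))\<^sup>2 = 2 * (a * b)\<^sup>2" if "r\<^sup>2 = b\<^sup>2" for r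
  proof -
    have "(norm (a *\<^sub>R u + r *\<^sub>R v))\<^sup>2 = a\<^sup>2 * (norm u)\<^sup>2 + r\<^sup>2 * (norm v)\<^sup>2"
      using orth by (subst norm_add_Pythagorean) (simp_all add: orthogonal_def power_mult_distrib)
    then show ?thesis
      using that by (simp add: a_def b_def power_mult_distrib)
  qed
  have img: "f (a *\<^sub>R u + r *\<^sub>R v) = a *\<^sub>R f u + r *\<^sub>R f v" for r
    using lin by (simp add: linear_add linear_scale)
  have "4 * (a * b) * inner (f u) (f v)
      = (norm (f (a *\<^sub>R u + b *\<^sub>R v)))\<^sup>2 - (norm (f (a *\<^sub>R u + (- b) *\<^sub>R v)))\<^sup>2"
    unfolding img by (simp add: power2_norm_eq_inner inner_add_left inner_add_right
        inner_diff_left inner_diff_right inner_commute [of "f v" "f u"] algebra_simps)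
  also have "\<dots> \<le> (1 + \<delta>) * (2 * (a * b)\<^sup>2) - (1 - \<delta>) * (2 * (a * b)\<^sup>2)"
    using rip [OF sp, of b] rip [OF sp, of "- b"] unfolding nrm [OF refl] nrm [OF power2_minus]
    by linarith
  also have "\<dots> = 4 * (a * b) * (\<delta> * b * a)"
    by (simp add: power2_eq_square algebra_simps)
  finally show ?thesis
    using ab by (simp add: a_def b_def)
qed

lemma inner_vrestrict_disjoint:
  fixes x y :: "'a::real_inner ^ 'n"
  assumes "A \<inter> B = {}"
  shows "inner (vrestrict A x) (vrestrict B y) = 0"
  unfolding inner_vec_def using assms by (intro sum.neutral) auto

lemma add_le_sqrt2_mult:
  fixes a b c :: real
  assumes "a\<^sup>2 + b\<^sup>2 \<le> c\<^sup>2" "c \<ge> 0"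
  shows "a + b \<le> sqrt 2 * c"
proof (rule power2_le_imp_le)
  have "(a + b)\<^sup>2 = 2 * (a\<^sup>2 + b\<^sup>2) - (a - b)\<^sup>2"
    by (simp add: power2_eq_square algebra_simps)
  also have "\<dots> \<le> 2 * (a\<^sup>2 + b\<^sup>2)"
    by simp
  also have "\<dots> \<le> 2 * c\<^sup>2"
    using assms(1) by simp
  finally have "(a + b)\<^sup>2 \<le> 2 * c\<^sup>2" .
  then show "(a + b)\<^sup>2 \<le> (sqrt 2 * c)\<^sup>2"
    by (simp add: power_mult_distrib)
qed (use assms in auto)

text \<open>A null space property: the part \<open>w\<close> of \<open>h\<close> on \<open>T\<close>
  and \<open>U\<close> is sparse, so its image is not small, yet the image of the remaining
  coordinates has to cancel it although the two are nearly orthogonal.\<close>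

lemma restricted_isometry_kernel_bound:
  fixes f :: "'a::real_inner ^ 'n \<Rightarrow> 'b::real_inner" and h :: "'a ^ 'n"
  assumes lin: "linear f" and s: "s \<ge> 1" and \<delta>: "0 \<le> \<delta>" "\<delta> < 1"
    and rip: "\<And>x. l0_norm x \<le> 2 * s \<Longrightarrow>
      (1 - \<delta>) * (norm x)\<^sup>2 \<le> (norm (f x))\<^sup>2 \<and> (norm (f x))\<^sup>2 \<le> (1 + \<delta>) * (norm x)\<^sup>2"
    and ker: "f h = 0" and T: "card T \<le> s"
  defines "\<rho> \<equiv> sqrt 2 * \<delta> / (1 - \<delta>)" and "\<sigma> \<equiv> (\<Sum>i\<in>- T. norm (h $ i))"
  shows "(\<Sum>i\<in>T. norm (h $ i)) \<le> \<rho> * \<sigma>" and "norm h \<le> (\<rho> + 1) * (\<sigma> / sqrt s)"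
proof -
  \<comment> \<open>The minimum covers the case of fewer than \<open>s\<close> coordinates outside
    \<open>T\<close>; then \<open>U\<close> exhausts them and \<open>R\<close> is empty.\<close>
  have "\<exists>U\<subseteq>- T. card U = min s (card (- T)) \<and>
      (\<forall>i\<in>U. \<forall>j\<in>- T - U. norm (h $ j) \<le> norm (h $ i))"
    by (rule largest_subset_exists) auto
  then obtain U where U: "U \<subseteq> - T" "card U = min s (card (- T))"
      "\<forall>i\<in>U. \<forall>j\<in>- T - U. norm (h $ j) \<le> norm (h $ i)"
    by auto
  define R where "R = - T - U"
  have UR: "U \<union> R = - T" "R \<inter> U = {}" and TR: "R \<inter> T = {}" and TU: "T \<inter> U = {}"
    and all: "(T \<union> U) \<union> R = UNIV" "(T \<union> U) \<inter> R = {}"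
    using U(1) by (auto simp: R_def)
  have cardU: "card U \<le> s"
    using U(2) by simp
  have R_cases: "R = {} \<or> card U = s"
  proof (cases "s \<le> card (- T)")
    case False
    then have "U = - T"
      using U(1,2) by (intro card_subset_eq) auto
    then show ?thesis by (simp add: R_def)
  qed (use U(2) in simp)
  have tail: "g R \<le> c * (\<sigma> / sqrt s)"
    if "c \<ge> 0"
      "\<And>A B. A \<subseteq> R \<Longrightarrow> B \<subseteq> R \<Longrightarrow> A \<inter> B = {} \<Longrightarrow> g (A \<union> B) \<le> g A + g B"
      "\<And>A. A \<subseteq> R \<Longrightarrow> card A \<le> s \<Longrightarrow> g A \<le> c * norm (vrestrict A h)" for g c
    unfolding \<sigma>_def UR(1) [symmetric]
  proof (rule subadditive_tail_bound [OF s that UR(2)])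
    show "R = {} \<or> card U = s"
      by (rule R_cases)
    show "\<forall>i\<in>U. \<forall>j\<in>R. norm (h $ j) \<le> norm (h $ i)"
      using U(3) by (simp add: R_def)
  qed
  \<comment> \<open>Used for \<open>T\<close> and \<open>U\<close> separately: either one together
    with a block is \<open>2 * s\<close>-sparse, whereas their union with a block could have
    \<open>3 * s\<close> nonzero coordinates.\<close>
  have cross: "- inner (f (vrestrict V h)) (f (vrestrict R h))
      \<le> \<delta> * norm (vrestrict V h) * (\<sigma> / sqrt s)"
    if V: "card V \<le> s" "V \<inter> R = {}" for V
  proof (rule tail [of "\<delta> * norm (vrestrict V h)" "\<lambda>A. - inner (f (vrestrict V h)) (f (vrestrict A h))"])
    fix A B :: "'n set" assume "A \<inter> B = {}"
    then show "- inner (f (vrestrict V h)) (f (vrestrict (A \<union> B) h))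
      \<le> - inner (f (vrestrict V h)) (f (vrestrict A h))
        + - inner (f (vrestrict V h)) (f (vrestrict B h))"
      using lin by (simp add: vrestrict_Un linear_add inner_add_right)
  next
    fix A assume A: "A \<subseteq> R" "card A \<le> s"
    have "inner (f (- vrestrict V h)) (f (vrestrict A h))
        \<le> \<delta> * norm (- vrestrict V h) * norm (vrestrict A h)"
    proof (rule restricted_isometry_inner_le [OF lin rip])
      show "l0_norm (- vrestrict V h) \<le> s"
        using l0_norm_scaleR_le [of "-1" "vrestrict V h"] l0_norm_vrestrict_le [of V h] V(1)
        by simp
      show "l0_norm (vrestrict A h) \<le> s"
        using l0_norm_vrestrict_le [of A h] A(2) by simp
      show "inner (- vrestrict V h) (vrestrict A h) = 0"
        using V(2) A(1) by (simp, intro inner_vrestrict_disjoint) auto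
    qed
    then show "- inner (f (vrestrict V h)) (f (vrestrict A h))
        \<le> \<delta> * norm (vrestrict V h) * norm (vrestrict A h)"
      using lin by (simp add: linear_neg)
  qed (use \<delta> in simp)
  define w where "w = vrestrict (T \<union> U) h"
  have w: "w = vrestrict T h + vrestrict U h"
    unfolding w_def using TU by (rule vrestrict_Un)
  have h: "w + vrestrict R h = h"
    unfolding w_def using vrestrict_Un [OF all(2), of h] all(1) by simp
  have w_norm: "(norm w)\<^sup>2 = (norm (vrestrict T h))\<^sup>2 + (norm (vrestrict U h))\<^sup>2"
    unfolding w by (rule norm_add_Pythagorean) (simp add: orthogonal_def inner_vrestrict_disjoint TU)
  have \<sigma>0: "\<sigma> \<ge> 0"
    by (simp add: \<sigma>_def sum_nonneg)
  have "l0_norm w \<le> 2 * s"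
    using l0_norm_add_le [of "vrestrict T h" "vrestrict U h"] l0_norm_vrestrict_le [of T h]
      l0_norm_vrestrict_le [of U h] T cardU unfolding w by linarith
  then have "(1 - \<delta>) * (norm w)\<^sup>2 \<le> (norm (f w))\<^sup>2"
    using rip by blast
  also have "\<dots> = - inner (f w) (f (vrestrict R h))"
  proof -
    have "f w + f (vrestrict R h) = 0"
      using ker h by (simp flip: linear_add [OF lin])
    then have "f (vrestrict R h) = - f w"
      by (simp add: eq_neg_iff_add_eq_0 add.commute)
    then show ?thesis
      by (simp add: power2_norm_eq_inner)
  qed
  also have "\<dots> \<le> \<delta> * norm (vrestrict T h) * (\<sigma> / sqrt s)
      + \<delta> * norm (vrestrict U h) * (\<sigma> / sqrt s)"
    using cross [of T] cross [of U] T cardU TR UR(2) lin unfolding w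
    by (simp add: linear_add inner_add_left Int_commute)
  also have "\<dots> = \<delta> * (\<sigma> / sqrt s) * (norm (vrestrict T h) + norm (vrestrict U h))"
    by (simp add: algebra_simps)
  \<comment> \<open>Recombining the two orthogonal pieces of \<open>w\<close> is the source of the
    factor \<open>sqrt 2\<close> in \<rho>.\<close>
  also have "\<dots> \<le> \<delta> * (\<sigma> / sqrt s) * (sqrt 2 * norm w)"
    using w_norm \<delta> \<sigma>0 by (intro mult_left_mono add_le_sqrt2_mult) auto
  finally have "((1 - \<delta>) * norm w) * norm w \<le> (sqrt 2 * \<delta> * (\<sigma> / sqrt s)) * norm w"
    by (simp add: power2_eq_square mult_ac)
  then have "norm w = 0 \<or> (1 - \<delta>) * norm w \<le> sqrt 2 * \<delta> * (\<sigma> / sqrt s)"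
    by (metis mult_right_le_imp_le norm_ge_zero order_le_less)
  then have "(1 - \<delta>) * norm w \<le> sqrt 2 * \<delta> * (\<sigma> / sqrt s)"
    using \<delta> \<sigma>0 by auto
  then have "norm w \<le> (sqrt 2 * \<delta> * (\<sigma> / sqrt s)) / (1 - \<delta>)"
    using \<delta>(2) by (intro mult_imp_le_div_pos) (simp_all only: mult.commute diff_gt_0_iff_gt)
  also have "\<dots> = \<rho> * (\<sigma> / sqrt s)"
    by (simp add: \<rho>_def)
  finally have head: "norm w \<le> \<rho> * (\<sigma> / sqrt s)" .
  have "norm (vrestrict T h) \<le> norm w"
    using w_norm by (auto intro: power2_le_imp_le)
  have "(\<Sum>i\<in>T. norm (h $ i)) \<le> sqrt s * norm (vrestrict T h)"
    using T by (rule sum_norm_le_sqrt_norm_vrestrict)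
  also have "\<dots> \<le> sqrt s * (\<rho> * (\<sigma> / sqrt s))"
    using \<open>norm (vrestrict T h) \<le> norm w\<close> head by (intro mult_left_mono) auto
  also have "\<dots> = \<rho> * \<sigma>"
    using s by simp
  finally show "(\<Sum>i\<in>T. norm (h $ i)) \<le> \<rho> * \<sigma>" .
  \<comment> \<open>The same block estimate, now for the norm itself, which is subadditive by the
    triangle inequality.\<close>
  have "norm (vrestrict R h) \<le> 1 * (\<sigma> / sqrt s)"
    by (rule tail [of 1 "\<lambda>A. norm (vrestrict A h)"])
      (auto simp: vrestrict_Un norm_triangle_ineq)
  moreover have "norm h \<le> norm w + norm (vrestrict R h)"
    using norm_triangle_ineq [of w "vrestrict R h"] h by simp
  ultimately show "norm h \<le> (\<rho> + 1) * (\<sigma> / sqrt s)"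
    using head unfolding distrib_right by linarith
qed

section \<open>Minimality of the 1-norm and the error estimate\<close>

text \<open>The reverse triangle inequality is used with \<open>x\<close> dominant on
  \<open>T\<close> and \<open>h\<close> dominant off \<open>T\<close>; the 1-norm of
  \<open>x\<close> on \<open>T\<close> then cancels.\<close>

lemma sum_norm_cone:
  fixes x h :: "'a::real_normed_vector ^ 'n"
  assumes "(\<Sum>i\<in>UNIV. norm ((x + h) $ i)) \<le> (\<Sum>i\<in>UNIV. norm (x $ i))"
  shows "(\<Sum>i\<in>- T. norm (h $ i)) \<le> (\<Sum>i\<in>T. norm (h $ i)) + 2 * (\<Sum>i\<in>- T. norm (x $ i))"
proof -
  have split: "(\<Sum>i\<in>UNIV. g i) = (\<Sum>i\<in>T. g i) + (\<Sum>i\<in>- T. g i)" for g :: "'n \<Rightarrow> real"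
    using sum.union_disjoint [of T "- T" g] by simp
  have "(\<Sum>i\<in>T. norm (x $ i) - norm (h $ i)) \<le> (\<Sum>i\<in>T. norm ((x + h) $ i))"
    by (intro sum_mono) (simp add: norm_diff_ineq)
  moreover have "(\<Sum>i\<in>- T. norm (h $ i) - norm (x $ i)) \<le> (\<Sum>i\<in>- T. norm ((x + h) $ i))"
    by (intro sum_mono) (simp add: norm_diff_ineq add.commute [of "x $ _"])
  ultimately show ?thesis
    using assms unfolding split by (simp add: sum_subtractf)
qed

text \<open>Stated for a general \<open>T\<close> so that both the coordinates kept by a best
  approximation and the support of a sparse vector can be inserted.\<close>

lemma l1_minimizer_error:
  fixes f :: "'a::real_inner ^ 'n \<Rightarrow> 'b::real_inner" and x z :: "'a ^ 'n"
  assumes lin: "linear f" and s: "s \<ge> 1" and \<delta>: "0 \<le> \<delta>" "\<delta> < sqrt 2 - 1"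
    and rip: "\<And>x. l0_norm x \<le> 2 * s \<Longrightarrow>
      (1 - \<delta>) * (norm x)\<^sup>2 \<le> (norm (f x))\<^sup>2 \<and> (norm (f x))\<^sup>2 \<le> (1 + \<delta>) * (norm x)\<^sup>2"
    and T: "card T \<le> s"
    and min: "is_arg_min (lp_norm 1) (\<lambda>z. f z = f x) z"
  defines "C \<equiv> 2 * ((1 + (sqrt 2 - 1) * \<delta>) / (1 - (sqrt 2 + 1) * \<delta>))"
    and "E \<equiv> (\<Sum>i\<in>- T. norm (x $ i))"
  shows "lp_norm 1 (z - x) \<le> C * E" and "lp_norm 2 (z - x) \<le> C / sqrt s * E"
proof -
  define h where "h = z - x"
  define \<rho> where "\<rho> = sqrt 2 * \<delta> / (1 - \<delta>)"
  define \<sigma> where "\<sigma> = (\<Sum>i\<in>- T. norm (h $ i))"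
  have "sqrt 2 < 2"
    by (simp add: real_sqrt_less_iff real_less_lsqrt)
  then have \<delta>1: "\<delta> < 1"
    using \<delta> by linarith
  \<comment> \<open>The right-hand side equals 1, so the threshold on \<delta> is exactly what makes
    \<rho> smaller than 1.\<close>
  have "(sqrt 2 + 1) * \<delta> < (sqrt 2 + 1) * (sqrt 2 - 1)"
    using \<delta> by (intro mult_strict_left_mono) (auto simp: add_pos_pos)
  then have den: "(sqrt 2 + 1) * \<delta> < 1"
    by (simp add: algebra_simps)
  then have \<rho>: "0 \<le> \<rho>" "\<rho> < 1"
    using \<delta> \<delta>1 by (auto simp: \<rho>_def divide_less_eq algebra_simps)
  have C: "C = 2 * (1 + \<rho>) / (1 - \<rho>)"
  proof -
    have "1 + \<rho> = (1 + (sqrt 2 - 1) * \<delta>) / (1 - \<delta>)"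
      "1 - \<rho> = (1 - (sqrt 2 + 1) * \<delta>) / (1 - \<delta>)"
      using \<delta>1 by (simp_all add: \<rho>_def field_simps)
    then show ?thesis
      using \<delta>1 by (simp add: C_def)
  qed
  have ker: "f h = 0"
    using min lin by (simp add: h_def is_arg_min_def linear_diff)
  note bound = restricted_isometry_kernel_bound
    [OF lin s \<delta>(1) \<delta>1 rip ker T, folded \<rho>_def \<sigma>_def]
  have "(\<Sum>i\<in>UNIV. norm ((x + h) $ i)) \<le> (\<Sum>i\<in>UNIV. norm (x $ i))"
    using min by (simp add: is_arg_min_linorder lp_norm_1 h_def)
  from sum_norm_cone [OF this, of T] have "\<sigma> \<le> \<rho> * \<sigma> + 2 * E"
    using bound(1) by (simp add: \<sigma>_def E_def)
  \<comment> \<open>The cone inequality bounds \<sigma> in terms of itself; \<rho> being below 1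
    allows absorbing that term.\<close>
  then have "\<sigma> \<le> 2 * E / (1 - \<rho>)"
    using \<rho> by (simp add: pos_le_divide_eq algebra_simps)
  then have "(\<rho> + 1) * \<sigma> \<le> (\<rho> + 1) * (2 * E / (1 - \<rho>))"
    using \<rho> by (intro mult_left_mono) auto
  also have "\<dots> = C * E"
    by (simp add: C add.commute mult_ac)
  finally have main: "(\<rho> + 1) * \<sigma> \<le> C * E" .
  have "lp_norm 1 h = (\<Sum>i\<in>T. norm (h $ i)) + \<sigma>"
    unfolding lp_norm_1 \<sigma>_def using sum.union_disjoint [of T "- T" "\<lambda>i. norm (h $ i)"] by simp
  also have "\<dots> \<le> (\<rho> + 1) * \<sigma>"
    using bound(1) by (simp add: distrib_right)
  finally show "lp_norm 1 (z - x) \<le> C * E"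
    using main by (simp add: h_def)
  have "lp_norm 2 h \<le> ((\<rho> + 1) * \<sigma>) / sqrt s"
    using bound(2) by (simp add: lp_norm_2)
  also have "\<dots> \<le> (C * E) / sqrt s"
    using main by (intro divide_right_mono) auto
  finally show "lp_norm 2 (z - x) \<le> C / sqrt s * E"
    by (simp add: h_def)
qed

section \<open>Application to quaternion matrices\<close>

lemma linear_matrix_vector_mult: "linear ((*v) A)"
  for A :: "'a::real_algebra_1 ^ 'n ^ 'm"
  by (rule linearI)
    (simp_all add: vec_eq_iff matrix_vector_mult_def distrib_left sum.distrib scaleR_sum_right)

theorem corollary5p1:
  fixes \<Phi> :: "quat ^ 'n ^ 'm" and s :: nat and \<delta> C\<^sub>0 :: real
  assumes "s \<ge> 1"
    and "restricted_isometry (2 * s) \<Phi> \<delta>"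
    and "\<delta> < sqrt 2 - 1"
    and "C\<^sub>0 = 2 * ((1 + (sqrt 2 - 1) * \<delta>) / (1 - (sqrt 2 + 1) * \<delta>))"
  shows "\<forall>(x :: quat ^ 'n) (y :: quat ^ 'm) x'.
    y = \<Phi> *v x \<longrightarrow> is_arg_min (lp_norm 1) (\<lambda>z. \<Phi> *v z = y) x' \<longrightarrow>
      (\<forall>x\<^sub>s. best_sparse_approx s x x\<^sub>s \<longrightarrow>
         lp_norm 1 (x' - x) \<le> C\<^sub>0 * lp_norm 1 (x - x\<^sub>s) \<and>
         lp_norm 2 (x' - x) \<le> C\<^sub>0 / sqrt (real s) * lp_norm 1 (x - x\<^sub>s)) \<and>
      (is_sparse s x \<longrightarrow> x' = x)"
proof (intro allI impI)
  fix x x' :: "quat ^ 'n" and y :: "quat ^ 'm"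
  assume "y = \<Phi> *v x" and "is_arg_min (lp_norm 1) (\<lambda>z. \<Phi> *v z = y) x'"
  then have min: "is_arg_min (lp_norm 1) (\<lambda>z. \<Phi> *v z = \<Phi> *v x) x'"
    by simp
  have \<delta>: "0 \<le> \<delta>"
    and rip: "\<And>x. l0_norm x \<le> 2 * s \<Longrightarrow>
      (1 - \<delta>) * (norm x)\<^sup>2 \<le> (norm (\<Phi> *v x))\<^sup>2 \<and> (norm (\<Phi> *v x))\<^sup>2 \<le> (1 + \<delta>) * (norm x)\<^sup>2"
    using assms(2) by (auto simp: restricted_isometry_def is_sparse_def lp_norm_2)
  note error = l1_minimizer_error
    [OF linear_matrix_vector_mult assms(1) \<delta> assms(3) rip _ min, folded assms(4)]
  have "lp_norm 1 (x' - x) \<le> C\<^sub>0 * lp_norm 1 (x - x\<^sub>s) \<and>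
      lp_norm 2 (x' - x) \<le> C\<^sub>0 / sqrt (real s) * lp_norm 1 (x - x\<^sub>s)"
    if approx: "best_sparse_approx s x x\<^sub>s" for x\<^sub>s
  proof -
    obtain S where S: "card S = min s CARD('n)" "x\<^sub>s = (\<chi> i. if i \<in> S then x $ i else 0)"
      using approx by (auto simp: best_sparse_approx_def)
    have "lp_norm 1 (x - x\<^sub>s) = (\<Sum>i\<in>- S. norm (x $ i))"
      unfolding lp_norm_1 S(2) by (rule sum.mono_neutral_cong_right) auto
    then show ?thesis
      using error [of S] S(1) by simp
  qed
  \<comment> \<open>With the support of \<open>x\<close> as \<open>T\<close>, nothing of
    \<open>x\<close> lies off \<open>T\<close>, so the error bound is 0.\<close>
  moreover have "x' = x" if "is_sparse s x"
    using error(2) [of "{i. x $ i \<noteq> 0}"] that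
    by (simp add: is_sparse_def l0_norm_def lp_norm_2)
  ultimately show "(\<forall>x\<^sub>s. best_sparse_approx s x x\<^sub>s \<longrightarrow>
         lp_norm 1 (x' - x) \<le> C\<^sub>0 * lp_norm 1 (x - x\<^sub>s) \<and>
         lp_norm 2 (x' - x) \<le> C\<^sub>0 / sqrt (real s) * lp_norm 1 (x - x\<^sub>s)) \<and>
      (is_sparse s x \<longrightarrow> x' = x)"
    by blast
qed

end
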